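(* For every binary radix system $(\Gamma,\pi,B)$ there is an admissible non-null pair $(\alpha,\beta)$ such that either $R(\alpha,\beta,-)=(\Gamma,\pi,B)$ or $R(\alpha,\beta,+)=(\Gamma,\pi,B)$.
   Context: Let $\Omega=\{0,1\}^{\infty}$ be the set of infinite strings $\omega=\omega_0\omega_1\omega_2\cdots$ with $\omega_n\in\{0,1\}$. The shift $S:\Omega\to\Omega$ is $S(\omega_0\omega_1\omega_2\cdots)=\omega_1\omega_2\cdots$, $S^n$ its $n$-th iterate. Lexicographic order on $\Omega$: $\sigma\prec\omega$ if $\sigma\neq\omega$ and $\sigma_k<\omega_k$ at the least index $k$ with $\sigma_k\neq\omega_k$; intervals $[\alpha,\beta]=\{\omega:\alpha\preceq\omega\preceq\beta\}$, and similarly $(\alpha,\beta]$, $[\alpha,\beta)$. Decimals: $\Omega^{\bullet}$ is the set of decimals $\omega_0\cdots\omega_N\bullet\omega_{N+1}\cdots$ obtained from an element of $\Omega$ by inserting a decimal point (initial zeros before the point may be added or omitted). For $\omega\in\Omega^{\bullet}$, $\widehat\omega\in\Omega$ is $\omega$ with the point removed; for $\Gamma\subseteq\Omega^{\bullet}$, $\widehat\Gamma=\{\widehat\omega:\omega\in\Gamma\}$; for $\Gamma\subseteq\Omega$, $\Gamma^{\bullet}$ is the set of all decimals obtained from strings of $\Gamma$ by placing the point anywhere. $\Gamma\subseteq\Omega^{\bullet}$ is shift invariant if $[S^n(\widehat\Gamma)]^{\bullet}=\Gamma$ for all $n\ge0$. Order on $\Omega^{\bullet}$: writing two decimals (padding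 with leading zeros) with the point after the same position, $\sigma\prec\omega$ iff $\sigma\ne\omega$ and $\widehat\sigma\prec\widehat\omega$. A binary radix system is a triple $(\Gamma,\pi,B)$ with $B>1$ real, $\Gamma\subseteq\Omega^{\bullet}$, $\pi:\Gamma\to[0,\infty)$, such that (i) $\Gamma$ is shift invariant, (ii) $\pi$ is bijective and strictly increasing, (iii) $\pi(\omega_0\cdots\omega_N\bullet\omega_{N+1}\cdots)=\sum_{n=-\infty}^{N}\omega_{N-n}B^n$ for all elements of $\Gamma$. A pair $(\alpha,\beta)$ in $\Omega$ is admissible if $\alpha_0=0,\alpha_1=1,\beta_0=1,\beta_1=0$, and $S^n\alpha\notin(\alpha,\beta]$, $S^n\beta\notin[\alpha,\beta)$ for all $n\ge0$. Define $\Omega_{(\alpha,\beta,-)}=\{\omega: S^n\omega\notin(\alpha,\beta]\ \forall n\ge0\}$, $\Omega_{(\alpha,\beta,+)}=\{\omega: S^n\omega\notin[\alpha,\beta)\ \forall n\ge0\}$, $\Omega_{(\alpha,\beta)}=\Omega_{(\alpha,\beta,-)}\cup\Omega_{(\alpha,\beta,+)}$, $\Omega^0_{(\alpha,\beta,-)}=\{\omega\in\Omega_{(\alpha,\beta,-)}:0\omega\preceq\alpha\}$, $\Omega^0_{(\alpha,\beta,+)}=\{\omega\in\Omega_{(\alpha,\beta,+)}:0\omega\prec\alpha\}$, and $\Omega^{\bullet}_{(\alpha,\beta,\pm)}=[\Omega^0_{(\alpha,\beta,\pm)}]^{\bullet}$. For $\Gamma\subseteq\Omega$ let $\Gamma_n=\{\gamma_0\cdots\gamma_{n-1}:\gamma\in\Gamma\}$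 and $h(\Gamma)=\limsup_{n}\frac1n\ln|\Gamma_n|$; the pair is null if $h(\Omega_{(\alpha,\beta)})=0$ and non-null otherwise. For an admissible non-null pair, let $b$ be the minimum solution in $[\tfrac12,1)$ of $\sum_{n\ge0}\alpha_nx^n=\sum_{n\ge0}\beta_nx^n$ (such a solution exists), $B_{(\alpha,\beta)}=1/b$, $\pi_{(\alpha,\beta)}(\omega_0\cdots\omega_N\bullet\omega_{N+1}\cdots)=\sum_{n=-\infty}^{N}\omega_{N-n}B_{(\alpha,\beta)}^n$, and $R(\alpha,\beta,\pm)=(\Omega^{\bullet}_{(\alpha,\beta,\pm)},\pi_{(\alpha,\beta)},B_{(\alpha,\beta)})$ (the $(\alpha,\beta)$-radix systems). *)

theory Defs
  imports "HOL-Analysis.Analysis" "HOL-Library.Fun_Lexorder"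
begin

type_synonym bstring = "nat \<Rightarrow> bool"

definition shift :: "bstring \<Rightarrow> bstring" where
  "shift \<omega> = (\<lambda>n. \<omega> (Suc n))"

definition cons0 :: "bstring \<Rightarrow> bstring" where
  "cons0 \<omega> = case_nat False \<omega>"

text \<open>The lexicographic order is the library's \<^const>\<open>less_fun\<close>; the order \<open><\<close> on functions is
  pointwise and is not used.\<close>

definition lex_le :: "bstring \<Rightarrow> bstring \<Rightarrow> bool" where
  "lex_le \<sigma> \<omega> \<longleftrightarrow> less_fun \<sigma> \<omega> \<or> \<sigma> = \<omega>"

definition lex_oc :: "bstring \<Rightarrow> bstring \<Rightarrow> bstring set" where
  "lex_oc \<alpha> \<beta> = {\<omega>. less_fun \<alpha> \<omega> \<and> lex_le \<omega> \<beta>}"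

definition lex_co :: "bstring \<Rightarrow> bstring \<Rightarrow> bstring set" where
  "lex_co \<alpha> \<beta> = {\<omega>. lex_le \<alpha> \<omega> \<and> less_fun \<omega> \<beta>}"

text \<open>A decimal is recorded by its digits, \<open>d n\<close> being the coefficient of \<open>B\<^sup>n\<close>, so that
  two ways of writing a decimal which differ only in initial zeros give the same object
  (lemma \<open>point_at_eq_iff\<close>).  The decimals are exactly the functions
  \<open>point_at N \<omega>\<close>, where the point is inserted in \<open>\<omega>\<close> after the digit with index \<open>N\<close>.\<close>

type_synonym decimal = "int \<Rightarrow> bool"

definition point_at :: "nat \<Rightarrow> bstring \<Rightarrow> decimal" where
  "point_at N \<omega> = (\<lambda>n. n \<le> int N \<and> \<omega> (nat (int N - n)))"

lemma point_at_eq_iff: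
  "point_at N \<sigma> = point_at (N + m) \<omega> \<longleftrightarrow> \<omega> = (cons0 ^^ m) \<sigma>"
proof -
  have cons0_pow: "(cons0 ^^ m) \<sigma> k \<longleftrightarrow> m \<le> k \<and> \<sigma> (k - m)" for k
    by (induction m arbitrary: k) (auto simp: cons0_def split: nat.split)
  show ?thesis
  proof
    assume eq: "point_at N \<sigma> = point_at (N + m) \<omega>"
    show "\<omega> = (cons0 ^^ m) \<sigma>"
    proof
      fix k
      from fun_cong[OF eq, of "int (N + m) - int k"]
      show "\<omega> k = (cons0 ^^ m) \<sigma> k"
        by (cases "m \<le> k") (auto simp: point_at_def cons0_pow nat_diff_distrib)
    qed
  next
    assume w: "\<omega> = (cons0 ^^ m) \<sigma>"
    show "point_at N \<sigma> = point_at (N + m) \<omega>"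
    proof
      fix n :: int
      have "m \<le> nat (int N + int m - n) \<longleftrightarrow> n \<le> int N" if "n \<le> int N + int m"
        using that by linarith
      moreover have "nat (int N + int m - n) - m = nat (int N - n)"
        by linarith
      ultimately show "point_at N \<sigma> n = point_at (N + m) \<omega> n"
        by (auto simp: point_at_def w cons0_pow)
    qed
  qed
qed

definition dot :: "bstring set \<Rightarrow> decimal set" where
  "dot \<Gamma> = {point_at N \<omega> | N \<omega>. \<omega> \<in> \<Gamma>}"

text \<open>Since initial zeros may be added or omitted, removing the point is applied to every way of
  writing a decimal.\<close>

definition hat :: "decimal set \<Rightarrow> bstring set" where
  "hat \<Gamma> = {\<omega>. \<exists>N. point_at N \<omega> \<in> \<Gamma>}"

definition shift_invariant :: "decimal set \<Rightarrow> bool" where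
  "shift_invariant \<Gamma> \<longleftrightarrow> (\<forall>n. dot ((shift ^^ n) ` hat \<Gamma>) = \<Gamma>)"

definition dec_less :: "decimal \<Rightarrow> decimal \<Rightarrow> bool" where
  "dec_less d e \<longleftrightarrow>
     (\<exists>N \<sigma> \<omega>. d = point_at N \<sigma> \<and> e = point_at N \<omega> \<and> d \<noteq> e \<and> less_fun \<sigma> \<omega>)"

definition dec_value :: "real \<Rightarrow> decimal \<Rightarrow> real" where
  "dec_value B d = (\<Sum>\<^sub>\<infinity>n. of_bool (d n) * B powi n)"

lemma dec_value_point_at:
  "dec_value B (point_at N \<omega>) = (\<Sum>\<^sub>\<infinity>n\<in>{..int N}. of_bool (\<omega> (nat (int N - n))) * B powi n)"
  unfolding dec_value_def by (rule infsum_cong_neutral) (auto simp: point_at_def)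

text \<open>A function with domain \<open>\<Gamma>\<close> is represented by its extension with the value
  \<^const>\<open>undefined\<close> outside \<open>\<Gamma>\<close>, so that radix systems can be compared by equality of triples.\<close>

definition binary_radix_system :: "decimal set \<Rightarrow> (decimal \<Rightarrow> real) \<Rightarrow> real \<Rightarrow> bool" where
  "binary_radix_system \<Gamma> \<pi> B \<longleftrightarrow>
     B > 1 \<and> \<Gamma> \<subseteq> dot UNIV \<and> \<pi> \<in> \<Gamma> \<rightarrow>\<^sub>E {0..} \<and>
     shift_invariant \<Gamma> \<and>
     bij_betw \<pi> \<Gamma> {0..} \<and> monotone_on \<Gamma> dec_less (<) \<pi> \<and>
     (\<forall>d\<in>\<Gamma>. \<pi> d = dec_value B d)"

definition admissible :: "bstring \<Rightarrow> bstring \<Rightarrow> bool" where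
  "admissible \<alpha> \<beta> \<longleftrightarrow>
     \<not> \<alpha> 0 \<and> \<alpha> 1 \<and> \<beta> 0 \<and> \<not> \<beta> 1 \<and>
     (\<forall>n. (shift ^^ n) \<alpha> \<notin> lex_oc \<alpha> \<beta> \<and> (shift ^^ n) \<beta> \<notin> lex_co \<alpha> \<beta>)"

definition Omega_minus :: "bstring \<Rightarrow> bstring \<Rightarrow> bstring set" where
  "Omega_minus \<alpha> \<beta> = {\<omega>. \<forall>n. (shift ^^ n) \<omega> \<notin> lex_oc \<alpha> \<beta>}"

definition Omega_plus :: "bstring \<Rightarrow> bstring \<Rightarrow> bstring set" where
  "Omega_plus \<alpha> \<beta> = {\<omega>. \<forall>n. (shift ^^ n) \<omega> \<notin> lex_co \<alpha> \<beta>}"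

definition Omega_pair :: "bstring \<Rightarrow> bstring \<Rightarrow> bstring set" where
  "Omega_pair \<alpha> \<beta> = Omega_minus \<alpha> \<beta> \<union> Omega_plus \<alpha> \<beta>"

definition Omega0_minus :: "bstring \<Rightarrow> bstring \<Rightarrow> bstring set" where
  "Omega0_minus \<alpha> \<beta> = {\<omega> \<in> Omega_minus \<alpha> \<beta>. lex_le (cons0 \<omega>) \<alpha>}"

definition Omega0_plus :: "bstring \<Rightarrow> bstring \<Rightarrow> bstring set" where
  "Omega0_plus \<alpha> \<beta> = {\<omega> \<in> Omega_plus \<alpha> \<beta>. less_fun (cons0 \<omega>) \<alpha>}"

definition initial_words :: "bstring set \<Rightarrow> nat \<Rightarrow> bool list set" where
  "initial_words \<Gamma> n = (\<lambda>\<gamma>. map \<gamma> [0..<n]) ` \<Gamma>"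

definition entropy :: "bstring set \<Rightarrow> ereal" where
  "entropy \<Gamma> = limsup (\<lambda>n. ereal (1 / real n * ln (real (card (initial_words \<Gamma> n)))))"

definition null_pair :: "bstring \<Rightarrow> bstring \<Rightarrow> bool" where
  "null_pair \<alpha> \<beta> \<longleftrightarrow> entropy (Omega_pair \<alpha> \<beta>) = 0"

definition pair_base :: "bstring \<Rightarrow> bstring \<Rightarrow> real" where
  "pair_base \<alpha> \<beta> = 1 / (LEAST x. x \<in> {1/2..<1} \<and>
     (\<Sum>n. of_bool (\<alpha> n) * x ^ n) = (\<Sum>n. of_bool (\<beta> n) * x ^ n))"

definition R_minus :: "bstring \<Rightarrow> bstring \<Rightarrow> decimal set \<times> (decimal \<Rightarrow> real) \<times> real" where
  "R_minus \<alpha> \<beta> =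
     (dot (Omega0_minus \<alpha> \<beta>),
      restrict (dec_value (pair_base \<alpha> \<beta>)) (dot (Omega0_minus \<alpha> \<beta>)),
      pair_base \<alpha> \<beta>)"

definition R_plus :: "bstring \<Rightarrow> bstring \<Rightarrow> decimal set \<times> (decimal \<Rightarrow> real) \<times> real" where
  "R_plus \<alpha> \<beta> =
     (dot (Omega0_plus \<alpha> \<beta>),
      restrict (dec_value (pair_base \<alpha> \<beta>)) (dot (Omega0_plus \<alpha> \<beta>)),
      pair_base \<alpha> \<beta>)"

end

theory Submission
  imports Defs
begin

text \<open>
  Let \<open>H\<close> be the set of strings of a radix system and \<open>val \<omega> = (\<Sum>n. \<omega>\<^sub>n B\<^bsup>-n\<^esup>)\<close>. Shift invariance
  and monotonicity force \<open>val\<close> to map \<open>H\<close> bijectively onto an interval \<open>[0, M]\<close> (sign \<open>-\<close>) or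
  \<open>[0, M)\<close> (sign \<open>+\<close>), and prefixing a zero identifies the strings of \<open>H\<close> with first digit 0 with
  the values up to \<open>M / B\<close>. So every string of \<open>H\<close> is the itinerary of its value under the map
  \<open>y \<mapsto> B y\<close> below \<open>M / B\<close>, \<open>y \<mapsto> B (y - 1)\<close> above \<open>M / B\<close>, and \<open>\<alpha>\<close>, \<open>\<beta>\<close> are the two itineraries
  of \<open>M / B\<close>. The strings all of whose shifts avoid the gap between \<open>\<alpha>\<close> and \<open>\<beta>\<close> are exactly the
  itineraries.
\<close>

section \<open>Binary strings\<close>

lemma funpow_shift_apply: "(shift ^^ n) \<omega> k = \<omega> (n + k)"
  by (induction n arbitrary: \<omega> k) (simp_all add: shift_def)

lemma funpow_shift_head: "(shift ^^ n) \<omega> 0 = \<omega> n"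
  by (simp add: funpow_shift_apply)

lemma funpow_shift_shift: "(shift ^^ n) (shift \<omega>) = (shift ^^ Suc n) \<omega>"
  by (simp add: funpow_swap1)

lemma shift_cons0 [simp]: "shift (cons0 \<omega>) = \<omega>"
  by (simp add: shift_def cons0_def)

lemma cons0_0 [simp]: "\<not> cons0 \<omega> 0"
  by (simp add: cons0_def)

lemma cons0_shift: "\<not> \<omega> 0 \<Longrightarrow> cons0 (shift \<omega>) = \<omega>"
  by (auto simp: cons0_def shift_def fun_eq_iff split: nat.split)

lemma less_fun_linear:
  fixes f g :: "'a::wellorder \<Rightarrow> 'b::linorder"
  shows "less_fun f g \<or> f = g \<or> less_fun g f"
proof (cases "f = g")
  case False
  then obtain i where "f i \<noteq> g i" by auto
  then obtain k where "f k \<noteq> g k" "\<forall>j<k. f j = g j"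
    using exists_least_iff[of "\<lambda>i. f i \<noteq> g i"] by blast
  then show ?thesis
    unfolding less_fun_def by (metis linorder_neqE)
qed simp

lemma not_less_fun_iff: "\<not> less_fun \<sigma> \<omega> \<longleftrightarrow> lex_le \<omega> \<sigma>"
  unfolding lex_le_def using less_fun_linear[of \<sigma> \<omega>] less_fun_asym less_fun_irrefl by blast

lemma less_fun_headI: "\<not> \<sigma> 0 \<Longrightarrow> \<omega> 0 \<Longrightarrow> less_fun \<sigma> (\<omega> :: bstring)"
  by (auto simp: less_fun_def)

text \<open>The sign \<open>\<plusminus>\<close> of the paper becomes a Boolean, true for \<open>+\<close>: the systems with sign \<open>+\<close> are those
  in which the inequalities are strict.\<close>

definition below :: "bool \<Rightarrow> 'a::linorder \<Rightarrow> 'a \<Rightarrow> bool" where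
  "below s y z \<longleftrightarrow> (if s then y < z else y \<le> z)"

definition lex_below :: "bool \<Rightarrow> bstring \<Rightarrow> bstring \<Rightarrow> bool" where
  "lex_below s \<sigma> \<omega> \<longleftrightarrow> (if s then less_fun \<sigma> \<omega> else lex_le \<sigma> \<omega>)"

definition Omega_pm :: "bool \<Rightarrow> bstring \<Rightarrow> bstring \<Rightarrow> bstring set" where
  "Omega_pm s \<alpha> \<beta> = (if s then Omega_plus \<alpha> \<beta> else Omega_minus \<alpha> \<beta>)"

definition Omega0_pm :: "bool \<Rightarrow> bstring \<Rightarrow> bstring \<Rightarrow> bstring set" where
  "Omega0_pm s \<alpha> \<beta> = (if s then Omega0_plus \<alpha> \<beta> else Omega0_minus \<alpha> \<beta>)"

lemma below_imp_le: "below s y z \<Longrightarrow> y \<le> z"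
  by (auto simp: below_def split: if_splits)

lemma less_imp_below: "y < z \<Longrightarrow> below s y z"
  by (auto simp: below_def)

lemma below_divide_iff: "0 < c \<Longrightarrow> below s (y / c) (z / c) \<longleftrightarrow> below s y (z :: real)"
  by (simp add: below_def divide_less_cancel divide_le_cancel)

lemma less_fun_imp_lex_below: "less_fun \<sigma> \<omega> \<Longrightarrow> lex_below s \<sigma> \<omega>"
  by (simp add: lex_below_def lex_le_def)

lemma mem_Omega_pm_iff:
  "\<omega> \<in> Omega_pm s \<alpha> \<beta> \<longleftrightarrow>
     (\<forall>n. lex_below s ((shift ^^ n) \<omega>) \<alpha> \<or> lex_below (\<not> s) \<beta> ((shift ^^ n) \<omega>))"
  by (auto simp: Omega_pm_def Omega_plus_def Omega_minus_def lex_co_def lex_oc_def lex_below_def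
      simp flip: not_less_fun_iff)

lemma mem_Omega_pm_iff_shift:
  "\<omega> \<in> Omega_pm s \<alpha> \<beta> \<longleftrightarrow>
     (lex_below s \<omega> \<alpha> \<or> lex_below (\<not> s) \<beta> \<omega>) \<and> shift \<omega> \<in> Omega_pm s \<alpha> \<beta>"
  unfolding mem_Omega_pm_iff funpow_shift_shift by (metis funpow_0 not0_implies_Suc)

lemma funpow_shift_mem_Omega_pm: "\<omega> \<in> Omega_pm s \<alpha> \<beta> \<Longrightarrow> (shift ^^ n) \<omega> \<in> Omega_pm s \<alpha> \<beta>"
  by (induction n) (simp_all, metis mem_Omega_pm_iff_shift)

lemma mem_Omega0_pm_iff:
  "\<omega> \<in> Omega0_pm s \<alpha> \<beta> \<longleftrightarrow> \<omega> \<in> Omega_pm s \<alpha> \<beta> \<and> lex_below s (cons0 \<omega>) \<alpha>"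
  by (simp add: Omega0_pm_def Omega_pm_def Omega0_plus_def Omega0_minus_def lex_below_def)

section \<open>Values of strings\<close>

definition strval :: "real \<Rightarrow> bstring \<Rightarrow> real" where
  "strval x \<omega> = (\<Sum>n. of_bool (\<omega> n) * x ^ n)"

context
  fixes x :: real
  assumes x_nonneg: "0 \<le> x" and x_less_1: "x < 1"
begin

lemma summable_strval: "summable (\<lambda>n. of_bool (\<omega> n) * x ^ n)"
  by (rule summable_comparison_test'[where g = "\<lambda>n. x ^ n" and N = 0])
     (use x_nonneg x_less_1 in \<open>auto simp: summable_geometric\<close>)

lemma strval_nonneg: "0 \<le> strval x \<omega>"
  unfolding strval_def by (rule suminf_nonneg[OF summable_strval]) (simp add: x_nonneg)

lemma strval_le: "strval x \<omega> \<le> 1 / (1 - x)"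
proof -
  have "strval x \<omega> \<le> (\<Sum>n. x ^ n)"
    unfolding strval_def
    by (rule suminf_le) (use x_nonneg x_less_1 in \<open>auto simp: summable_geometric summable_strval\<close>)
  then show ?thesis using x_nonneg x_less_1 by (simp add: suminf_geometric)
qed

lemma strval_split_initial_segment:
  "strval x \<omega> = (\<Sum>i<n. of_bool (\<omega> i) * x ^ i) + x ^ n * strval x ((shift ^^ n) \<omega>)"
proof -
  have "(\<Sum>i. of_bool (\<omega> (i + n)) * x ^ (i + n))
      = x ^ n * (\<Sum>i. of_bool ((shift ^^ n) \<omega> i) * x ^ i)"
    using suminf_mult[OF summable_strval, of "x ^ n" "(shift ^^ n) \<omega>"]
    by (simp add: funpow_shift_apply power_add mult_ac add.commute)
  then show ?thesis
    unfolding strval_def using suminf_split_initial_segment[OF summable_strval, of \<omega> n] by simp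
qed

lemma strval_unfold: "strval x \<omega> = of_bool (\<omega> 0) + x * strval x (shift \<omega>)"
  using strval_split_initial_segment[of \<omega> 1] by simp

lemma strval_diff_common_prefix:
  assumes "\<forall>j<k. \<sigma> j = \<tau> j"
  shows "strval x \<sigma> - strval x \<tau> = x ^ k * (strval x ((shift ^^ k) \<sigma>) - strval x ((shift ^^ k) \<tau>))"
  using assms strval_split_initial_segment[of \<sigma> k] strval_split_initial_segment[of \<tau> k]
  by (simp add: right_diff_distrib)

lemma le_0_if_le_geometric:
  assumes "\<And>n. d \<le> C * x ^ n"
  shows "d \<le> 0"
proof -
  have "(\<lambda>n. C * x ^ n) \<longlonglongrightarrow> C * 0"
    using x_nonneg x_less_1 by (intro tendsto_mult LIMSEQ_realpow_zero tendsto_const) auto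
  then show ?thesis
    using LIMSEQ_le_const[of "\<lambda>n. C * x ^ n" 0 d] assms by auto
qed

end

lemma dec_value_point_at_eq_strval:
  assumes "B > 1"
  shows "dec_value B (point_at N \<omega>) = B ^ N * strval (1 / B) \<omega>"
proof -
  let ?g = "\<lambda>n. of_bool (\<omega> n) * (1 / B) ^ n"
  have bij: "bij_betw (\<lambda>k. int N - int k) UNIV {..int N}"
    by (rule bij_betwI[where g = "\<lambda>n. nat (int N - n)"]) auto
  have summable: "summable ?g" using assms by (intro summable_strval) auto
  have "dec_value B (point_at N \<omega>)
      = (\<Sum>\<^sub>\<infinity>n\<in>{..int N}. of_bool (\<omega> (nat (int N - n))) * B powi n)"
    by (rule dec_value_point_at)
  also have "\<dots> = (\<Sum>\<^sub>\<infinity>k. of_bool (\<omega> k) * B powi (int N - int k))"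
    by (subst infsum_reindex_bij_betw[OF bij, symmetric]) simp
  also have "\<dots> = (\<Sum>\<^sub>\<infinity>k. B ^ N * ?g k)"
    using assms by (intro infsum_cong) (simp add: power_int_diff power_divide)
  also have "\<dots> = B ^ N * (\<Sum>\<^sub>\<infinity>k. ?g k)"
    by (rule infsum_cmult_right')
  also have "(\<Sum>\<^sub>\<infinity>k. ?g k) = strval (1 / B) \<omega>"
    unfolding strval_def using summable summable_sums assms
    by (intro infsumI norm_summable_imp_has_sum) auto
  finally show ?thesis .
qed

locale radix_base =
  fixes B :: real
  assumes B_gt_1: "1 < B"
begin

abbreviation val :: "bstring \<Rightarrow> real" where "val \<equiv> strval (1 / B)"

lemma inverse_base_bounds: "0 \<le> 1 / B" "1 / B < 1"
  using B_gt_1 by auto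

lemmas val_nonneg = strval_nonneg[OF inverse_base_bounds]
lemmas val_le = strval_le[OF inverse_base_bounds]

lemma val_cons0: "val (cons0 \<omega>) = val \<omega> / B"
  using strval_unfold[OF inverse_base_bounds, of "cons0 \<omega>"] by simp

lemma val_shift: "val (shift \<omega>) = B * (val \<omega> - of_bool (\<omega> 0))"
  using strval_unfold[OF inverse_base_bounds, of \<omega>] B_gt_1 by (simp add: field_simps)

end

section \<open>Entropy of string sets whose values fill an interval\<close>

lemma finite_initial_words: "finite (initial_words \<Gamma> n)"
  by (rule finite_subset[OF _ finite_lists_length_eq[of UNIV n]]) (auto simp: initial_words_def)

lemma interval_length_le_card_initial_words:
  assumes "0 \<le> x" "x < 1" and "a \<le> b" and subset_values: "{a..b} \<subseteq> strval x ` \<Gamma>"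
  shows "b - a \<le> real (card (initial_words \<Gamma> n)) * (x ^ n / (1 - x))"
proof -
  define prefix_value where "prefix_value w = (\<Sum>i<n. of_bool (w ! i) * x ^ i)" for w
  define cell where "cell w = {prefix_value w .. prefix_value w + x ^ n / (1 - x)}" for w
  let ?W = "initial_words \<Gamma> n"
  have "strval x \<omega> \<in> cell (map \<omega> [0..<n])" for \<omega>
  proof -
    have "prefix_value (map \<omega> [0..<n]) = (\<Sum>i<n. of_bool (\<omega> i) * x ^ i)"
      by (simp add: prefix_value_def)
    moreover have "x ^ n * strval x ((shift ^^ n) \<omega>) \<le> x ^ n * (1 / (1 - x))"
      using assms by (intro mult_left_mono strval_le) auto
    moreover have "0 \<le> x ^ n * strval x ((shift ^^ n) \<omega>)"
      using assms by (simp add: strval_nonneg)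
    ultimately show ?thesis
      using strval_split_initial_segment[OF assms(1,2), of \<omega> n] by (simp add: cell_def)
  qed
  then have cover: "{a..b} \<subseteq> (\<Union>w\<in>?W. cell w)"
    using subset_values by (fastforce simp: initial_words_def)
  have "b - a = measure lborel {a..b}" using assms(3) by simp
  also have "\<dots> \<le> measure lborel (\<Union>w\<in>?W. cell w)"
    using cover finite_initial_words
    by (intro measure_mono_fmeasurable fmeasurable.finite_UN)
      (auto simp: cell_def fmeasurable_def emeasure_lborel_Icc_eq)
  also have "\<dots> \<le> (\<Sum>w\<in>?W. measure lborel (cell w))"
    by (intro measure_UNION_le finite_initial_words) (simp add: cell_def)
  also have "\<dots> = real (card ?W) * (x ^ n / (1 - x))"
    using assms by (simp add: cell_def)
  finally show ?thesis .
qed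

lemma entropy_ge_if_interval_subset_values:
  assumes x_bounds: "0 < x" "x < 1" and interval: "a < b" "{a..b} \<subseteq> strval x ` \<Gamma>"
  shows "ereal (- ln x) \<le> entropy \<Gamma>"
proof -
  define D where "D = (b - a) * (1 - x)"
  let ?words = "\<lambda>n. real (card (initial_words \<Gamma> n))"
  have D_pos: "0 < D" using x_bounds interval by (simp add: D_def)
  have lower_bound: "ln D / real n - ln x \<le> 1 / real n * ln (?words n)" if "n \<ge> 1" for n
  proof -
    have "D \<le> ?words n * x ^ n"
      using interval_length_le_card_initial_words[of x a b \<Gamma> n] x_bounds interval
      by (simp add: D_def field_simps)
    then have "D / x ^ n \<le> ?words n" using x_bounds by (simp add: field_simps)
    then have "ln (D / x ^ n) \<le> ln (?words n)" using x_bounds D_pos by (intro ln_mono) auto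
    then have "(ln D - real n * ln x) / real n \<le> ln (?words n) / real n"
      using x_bounds D_pos by (intro divide_right_mono) (auto simp: ln_div ln_realpow)
    then show ?thesis using that by (simp add: diff_divide_distrib)
  qed
  have "(\<lambda>n. ln D / real n - ln x) \<longlonglongrightarrow> 0 - ln x"
    by (intro tendsto_intros lim_const_over_n)
  then have "ereal (- ln x) = limsup (\<lambda>n. ereal (ln D / real n - ln x))"
    by (intro lim_imp_Limsup[symmetric]) auto
  also have "\<dots> \<le> entropy \<Gamma>"
    unfolding entropy_def
    by (intro Limsup_mono eventually_sequentiallyI[of 1]) (use lower_bound in simp)
  finally show ?thesis .
qed

section \<open>Itineraries of an expanding map with one discontinuity\<close>

locale critical_map = radix_base B for B :: real +
  fixes M :: real
  assumes B_le_M: "B \<le> M" and right_branch_le: "B * (M - 1) \<le> M"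
begin

definition crit :: real where "crit = M / B"

text \<open>The branches \<open>y \<mapsto> B * y\<close> and \<open>y \<mapsto> B * (y - 1)\<close> meet at \<open>crit\<close>, which belongs to the right-hand
  branch iff \<open>s\<close> holds.\<close>

definition digit :: "bool \<Rightarrow> real \<Rightarrow> bool" where
  "digit s y \<longleftrightarrow> below (\<not> s) crit y"

definition T :: "bool \<Rightarrow> real \<Rightarrow> real" where
  "T s y = B * (y - of_bool (digit s y))"

definition itin :: "bool \<Rightarrow> real \<Rightarrow> bstring" where
  "itin s y n = digit s ((T s ^^ n) y)"

definition \<alpha> :: bstring where "\<alpha> = itin False crit"
definition \<beta> :: bstring where "\<beta> = itin True crit"

lemma not_digit_iff: "\<not> digit s y \<longleftrightarrow> below s y crit"
  by (auto simp: digit_def below_def)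

lemma B_crit: "B * crit = M"
  using B_gt_1 by (simp add: crit_def)

lemma below_divide_crit_iff: "below s (y / B) crit \<longleftrightarrow> below s y M"
  unfolding crit_def using B_gt_1 by (intro below_divide_iff) simp

lemma one_le_crit: "1 \<le> crit"
  using B_gt_1 B_le_M by (simp add: crit_def)

lemma crit_less_M: "crit < M"
  using B_gt_1 B_le_M by (simp add: crit_def divide_less_eq)

lemma crit_range: "0 \<le> crit" "crit \<le> M"
  using one_le_crit crit_less_M by auto

lemma M_minus_B_less_crit: "M - B < crit"
proof -
  have "B * (M - B) = B * (M - 1) - B * (B - 1)" by (simp add: algebra_simps)
  moreover have "0 < B * (B - 1)" using B_gt_1 by simp
  ultimately have "B * (M - B) < M" using right_branch_le by linarith
  then show ?thesis using B_gt_1 by (simp add: crit_def field_simps)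
qed

lemma B_le_2: "B \<le> 2"
proof -
  have "B * (B - 1) \<le> M * (B - 1)" using B_gt_1 B_le_M by (intro mult_right_mono) auto
  also have "\<dots> \<le> B * 1" using right_branch_le by (simp add: algebra_simps)
  finally show ?thesis using B_gt_1 by simp
qed

lemma T_range:
  assumes "0 \<le> y" "y \<le> M"
  shows "0 \<le> T s y" "T s y \<le> M"
proof -
  have left_branch: "B * y \<le> M" if "\<not> digit s y"
    using below_imp_le[of s y crit] that B_gt_1 by (simp add: not_digit_iff crit_def field_simps)
  have right_branch: "1 \<le> y" if "digit s y"
    using below_imp_le[of "\<not> s" crit y] that one_le_crit by (simp add: digit_def)
  show "0 \<le> T s y"
    using right_branch assms B_gt_1 by (simp add: T_def)
  have "B * (y - 1) \<le> B * (M - 1)" using assms B_gt_1 by simp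
  then show "T s y \<le> M"
    using left_branch right_branch_le by (auto simp: T_def)
qed

lemma T_funpow_range: "0 \<le> y \<Longrightarrow> y \<le> M \<Longrightarrow> 0 \<le> (T s ^^ n) y \<and> (T s ^^ n) y \<le> M"
  by (induction n) (auto simp: T_range)

lemma itin_0: "itin s y 0 = digit s y"
  by (simp add: itin_def)

lemma shift_itin: "shift (itin s y) = itin s (T s y)"
  by (rule ext) (simp add: shift_def itin_def funpow_swap1)

lemma funpow_shift_itin: "(shift ^^ n) (itin s y) = itin s ((T s ^^ n) y)"
  by (induction n) (simp_all add: shift_itin)

lemma itin_divide_B:
  assumes "below s y M"
  shows "itin s (y / B) = cons0 (itin s y)"
proof -
  have "\<not> digit s (y / B)" using assms by (simp add: not_digit_iff below_divide_crit_iff)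
  then show ?thesis
    using cons0_shift[of "itin s (y / B)"] B_gt_1 by (simp add: itin_0 shift_itin T_def)
qed

lemma minus_val_itin_eq_remainder:
  "y - val (itin s y) = ((T s ^^ n) y - val (itin s ((T s ^^ n) y))) * (1 / B) ^ n"
proof (induction n)
  case (Suc n)
  let ?z = "(T s ^^ n) y"
  have "T s ?z - val (itin s (T s ?z)) = B * (?z - val (itin s ?z))"
    using val_shift[of "itin s ?z"] by (simp add: shift_itin itin_0 T_def algebra_simps)
  then show ?case using Suc B_gt_1 by simp
qed simp

lemma val_itin:
  assumes "0 \<le> y" "y \<le> M"
  shows "val (itin s y) = y"
proof -
  define C where "C = M + 1 / (1 - 1 / B)"
  let ?remainder = "\<lambda>n. (T s ^^ n) y - val (itin s ((T s ^^ n) y))"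
  have "\<bar>?remainder n\<bar> \<le> C" for n
    using T_funpow_range[OF assms, of n s] val_nonneg[of "itin s ((T s ^^ n) y)"]
      val_le[of "itin s ((T s ^^ n) y)"] by (auto simp: C_def)
  then have "\<bar>y - val (itin s y)\<bar> \<le> C * (1 / B) ^ n" for n
    unfolding minus_val_itin_eq_remainder[of y s n] abs_mult
    using B_gt_1 by (simp add: mult_right_mono divide_right_mono)
  then show ?thesis
    using le_0_if_le_geometric[OF inverse_base_bounds, of "\<bar>y - val (itin s y)\<bar>" C]
    by simp
qed

lemma eq_itin_val:
  assumes "\<And>n. \<omega> n = digit s (val ((shift ^^ n) \<omega>))"
  shows "\<omega> = itin s (val \<omega>)"
proof
  fix n
  have "(T s ^^ m) (val \<omega>) = val ((shift ^^ m) \<omega>)" for m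
  proof (induction m)
    case (Suc m)
    then show ?case
      using assms[of m] by (simp add: T_def[of s "val _"] val_shift funpow_shift_head)
  qed simp
  then show "\<omega> n = itin s (val \<omega>) n" using assms by (simp add: itin_def)
qed

lemma val_\<alpha>: "val \<alpha> = crit" and val_\<beta>: "val \<beta> = crit"
  unfolding \<alpha>_def \<beta>_def using val_itin[OF crit_range] by auto

lemma \<alpha>_0: "\<not> \<alpha> 0" and \<beta>_0: "\<beta> 0"
  by (auto simp: \<alpha>_def \<beta>_def itin_0 digit_def below_def)

subsection \<open>Lexicographic comparison and values\<close>

definition misplacement :: "bstring \<Rightarrow> real" where
  "misplacement \<omega> = (if \<omega> 0 then crit - val \<omega> else val \<omega> - crit)"

lemma misplacement_itin_nonpos:
  assumes "0 \<le> y" "y \<le> M"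
  shows "misplacement (itin s y) \<le> 0"
  using val_itin[OF assms]
  by (auto simp: misplacement_def itin_0 digit_def below_def split: if_splits)

lemma misplacement_itin_neg:
  assumes "0 \<le> y" "y \<le> M" "digit s y \<noteq> s"
  shows "misplacement (itin s y) < 0"
  using val_itin[OF assms(1,2)] assms(3)
  by (auto simp: misplacement_def itin_0 digit_def below_def split: if_splits)

lemma val_diff_eq_misplacements:
  assumes "\<forall>j<k. \<sigma> j = \<tau> j" "\<not> \<sigma> k" "\<tau> k"
  shows "val \<sigma> - val \<tau> =
    (misplacement ((shift ^^ k) \<sigma>) + misplacement ((shift ^^ k) \<tau>)) * (1 / B) ^ k"
  using strval_diff_common_prefix[OF inverse_base_bounds assms(1)] assms(2,3)
  by (simp add: misplacement_def funpow_shift_head)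

lemma itin_le_imp_le:
  assumes "lex_le (itin s y) (itin s' z)" "0 \<le> y" "y \<le> M" "0 \<le> z" "z \<le> M"
  shows "y \<le> z"
proof (cases "itin s y = itin s' z")
  case True
  then show ?thesis using assms val_itin by (metis order_refl)
next
  case False
  then have "less_fun (itin s y) (itin s' z)" using assms(1) by (simp add: lex_le_def)
  then obtain k where "\<forall>j<k. itin s y j = itin s' z j" "\<not> itin s y k" "itin s' z k"
    by (auto simp: less_fun_def)
  then have "val (itin s y) - val (itin s' z) =
      (misplacement (itin s ((T s ^^ k) y)) + misplacement (itin s' ((T s' ^^ k) z))) * (1 / B) ^ k"
    using val_diff_eq_misplacements[of k "itin s y" "itin s' z"] by (simp add: funpow_shift_itin)
  also have "\<dots> \<le> 0"
    using assms B_gt_1 T_funpow_range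
    by (intro mult_nonpos_nonneg add_nonpos_nonpos misplacement_itin_nonpos) auto
  finally show ?thesis using assms by (simp add: val_itin)
qed

lemma itin_strict_mono:
  assumes "y < z" "0 \<le> y" "z \<le> M"
  shows "less_fun (itin s y) (itin s' z)"
proof (rule ccontr)
  assume "\<not> less_fun (itin s y) (itin s' z)"
  then have "lex_le (itin s' z) (itin s y)" by (simp add: not_less_fun_iff)
  then have "z \<le> y" by (rule itin_le_imp_le) (use assms in auto)
  then show False using assms(1) by simp
qed

lemma lex_below_itin_\<alpha>:
  assumes "0 \<le> y" "y \<le> M" "\<not> digit s y"
  shows "lex_below s (itin s y) \<alpha>"
proof (cases "y = crit")
  case True
  then show ?thesis
    using assms(3)
    by (simp add: \<alpha>_def digit_def below_def lex_below_def lex_le_def split: if_splits)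
next
  case False
  then have "y < crit" using assms(3) below_imp_le[of s y crit] by (simp add: not_digit_iff)
  then show ?thesis
    unfolding \<alpha>_def using assms crit_range by (intro less_fun_imp_lex_below itin_strict_mono)
qed

lemma lex_below_\<beta>_itin:
  assumes "0 \<le> y" "y \<le> M" "digit s y"
  shows "lex_below (\<not> s) \<beta> (itin s y)"
proof (cases "y = crit")
  case True
  then show ?thesis
    using assms(3)
    by (simp add: \<beta>_def digit_def below_def lex_below_def lex_le_def split: if_splits)
next
  case False
  then have "crit < y" using assms(3) below_imp_le[of "\<not> s" crit y] by (simp add: digit_def)
  then show ?thesis
    unfolding \<beta>_def using assms crit_range by (intro less_fun_imp_lex_below itin_strict_mono)
qed

lemma itin_mem_Omega_pm:
  assumes "0 \<le> y" "y \<le> M"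
  shows "itin s y \<in> Omega_pm s \<alpha> \<beta>"
  unfolding mem_Omega_pm_iff funpow_shift_itin
  using lex_below_itin_\<alpha> lex_below_\<beta>_itin T_funpow_range[OF assms] by blast

lemma admissible_\<alpha>_\<beta>: "admissible \<alpha> \<beta>"
proof -
  have "T False crit = M" "T True crit = M - B"
    using B_crit by (simp_all add: T_def digit_def below_def right_diff_distrib)
  then have "\<alpha> 1" "\<not> \<beta> 1"
    using crit_less_M M_minus_B_less_crit
    by (simp_all add: \<alpha>_def \<beta>_def itin_def digit_def below_def)
  moreover have "(shift ^^ n) \<alpha> \<notin> lex_oc \<alpha> \<beta>" "(shift ^^ n) \<beta> \<notin> lex_co \<alpha> \<beta>" for n
    using itin_mem_Omega_pm[OF crit_range, of False] itin_mem_Omega_pm[OF crit_range, of True]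
    by (auto simp: \<alpha>_def \<beta>_def Omega_pm_def Omega_minus_def Omega_plus_def)
  ultimately show ?thesis
    using \<alpha>_0 \<beta>_0 by (auto simp: admissible_def)
qed

subsection \<open>The strings that avoid the gap are the itineraries\<close>

text \<open>A positive misplacement of a string that avoids the gap would be less than \<open>B\<^bsup>-k\<^esup>\<close> times that
  of its \<open>k\<close>-th shift, for some \<open>k > 0\<close>. As misplacements are bounded, this cannot go on.\<close>

lemma misplacement_less_later_misplacement:
  assumes "less_fun \<sigma> \<alpha> \<or> less_fun \<beta> \<sigma>"
  obtains k where "k > 0" "misplacement \<sigma> < misplacement ((shift ^^ k) \<sigma>) * (1 / B) ^ k"
proof -
  obtain s where "if s then less_fun (itin s crit) \<sigma> else less_fun \<sigma> (itin s crit)"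
    using assms unfolding \<alpha>_def \<beta>_def by metis
  then obtain k where first_difference: "\<sigma> k = s" "itin s crit k \<noteq> s" "\<forall>j<k. \<sigma> j = itin s crit j"
    by (auto simp: less_fun_def split: if_splits)
  have itin_crit_0: "itin s crit 0 = s" by (simp add: itin_0 digit_def below_def)
  then have "k > 0" using first_difference(2) by (cases k) auto
  then have "\<sigma> 0 = s" using first_difference(3) itin_crit_0 by simp
  then have "misplacement \<sigma> =
      (misplacement ((shift ^^ k) \<sigma>) + misplacement ((shift ^^ k) (itin s crit))) * (1 / B) ^ k"
    using val_diff_eq_misplacements[of k \<sigma> "itin s crit"]
      val_diff_eq_misplacements[of k "itin s crit" \<sigma>] first_difference val_itin[OF crit_range, of s]
    by (cases s) (simp_all add: misplacement_def[of \<sigma>] add.commute)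
  moreover have "misplacement ((shift ^^ k) (itin s crit)) < 0"
    unfolding funpow_shift_itin using T_funpow_range[OF crit_range] first_difference(2)
    by (intro misplacement_itin_neg) (auto simp: itin_def)
  ultimately have "misplacement \<sigma> < misplacement ((shift ^^ k) \<sigma>) * (1 / B) ^ k"
    using B_gt_1 by (simp add: divide_strict_right_mono)
  then show ?thesis using that \<open>k > 0\<close> by blast
qed

lemma Omega_pm_cases:
  assumes "\<omega> \<in> Omega_pm s \<alpha> \<beta>"
  obtains (strict) "less_fun \<omega> \<alpha> \<or> less_fun \<beta> \<omega>" | (crit) "\<omega> = itin s crit"
  using assms unfolding mem_Omega_pm_iff_shift[of \<omega>] \<alpha>_def \<beta>_def
  by (auto simp: lex_below_def lex_le_def split: if_splits)

lemma misplacement_nonpos: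
  assumes "\<omega> \<in> Omega_pm s \<alpha> \<beta>"
  shows "misplacement \<omega> \<le> 0"
proof -
  define C where "C = 1 / (1 - 1 / B) + crit"
  have misplacement_le: "misplacement \<sigma> \<le> C" for \<sigma>
    using val_nonneg[of \<sigma>] val_le[of \<sigma>] crit_range(1) by (auto simp: misplacement_def C_def)
  have C_nonneg: "0 \<le> C" using B_gt_1 crit_range by (simp add: C_def)
  have "misplacement \<sigma> \<le> C * (1 / B) ^ n" if "\<sigma> \<in> Omega_pm s \<alpha> \<beta>" for \<sigma> n
    using that
  proof (induction n arbitrary: \<sigma>)
    case 0
    then show ?case using misplacement_le by simp
  next
    case (Suc n)
    from Suc.prems show ?case
    proof (cases rule: Omega_pm_cases)
      case strict
      then obtain k where "k > 0" "misplacement \<sigma> < misplacement ((shift ^^ k) \<sigma>) * (1 / B) ^ k"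
        by (rule misplacement_less_later_misplacement)
      note this(2)
      also have "misplacement ((shift ^^ k) \<sigma>) * (1 / B) ^ k \<le> C * (1 / B) ^ n * (1 / B) ^ k"
        using Suc B_gt_1 funpow_shift_mem_Omega_pm by (intro mult_right_mono) auto
      also have "\<dots> \<le> C * (1 / B) ^ n * (1 / B) ^ 1"
        using \<open>k > 0\<close> B_gt_1 C_nonneg by (intro mult_left_mono power_decreasing) auto
      finally show ?thesis by simp
    next
      case crit
      then have "misplacement \<sigma> \<le> 0" using misplacement_itin_nonpos[OF crit_range] by simp
      also have "0 \<le> C * (1 / B) ^ Suc n" using C_nonneg B_gt_1 by simp
      finally show ?thesis .
    qed
  qed
  then show ?thesis
    using assms le_0_if_le_geometric[OF inverse_base_bounds] by blast
qed

lemma Omega_pm_head_eq_digit: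
  assumes "\<omega> \<in> Omega_pm s \<alpha> \<beta>"
  shows "\<omega> 0 = digit s (val \<omega>)"
  using assms
proof (cases rule: Omega_pm_cases)
  case strict
  then obtain k where "misplacement \<omega> < misplacement ((shift ^^ k) \<omega>) * (1 / B) ^ k"
    by (rule misplacement_less_later_misplacement)
  also have "\<dots> \<le> 0"
    using misplacement_nonpos[OF funpow_shift_mem_Omega_pm[OF assms]] B_gt_1
    by (intro mult_nonpos_nonneg) auto
  finally show ?thesis
    by (auto simp: misplacement_def digit_def below_def split: if_splits)
qed (simp add: itin_0 val_itin[OF crit_range])

lemma Omega_pm_eq_itin_val: "\<omega> \<in> Omega_pm s \<alpha> \<beta> \<Longrightarrow> \<omega> = itin s (val \<omega>)"
  using Omega_pm_head_eq_digit funpow_shift_mem_Omega_pm funpow_shift_head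
  by (intro eq_itin_val) metis

lemma itin_mem_Omega0_pm:
  assumes "0 \<le> y" "below s y M"
  shows "itin s y \<in> Omega0_pm s \<alpha> \<beta>"
proof -
  have "below s (y / B) crit" using assms(2) by (simp add: below_divide_crit_iff)
  then have "\<not> digit s (y / B)" "0 \<le> y / B" "y / B \<le> M"
    using assms(1) B_gt_1 crit_range(2) below_imp_le[of s "y / B" crit]
    by (simp_all add: not_digit_iff)
  then have "lex_below s (cons0 (itin s y)) \<alpha>"
    using lex_below_itin_\<alpha>[of "y / B" s] itin_divide_B[OF assms(2)] by simp
  then show ?thesis
    using itin_mem_Omega_pm[OF assms(1) below_imp_le[OF assms(2)]] by (simp add: mem_Omega0_pm_iff)
qed

lemma Omega0_pm_val_below_M:
  assumes "\<omega> \<in> Omega0_pm s \<alpha> \<beta>"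
  shows "below s (val \<omega>) M"
proof -
  have "cons0 \<omega> \<in> Omega_pm s \<alpha> \<beta>"
    using assms mem_Omega_pm_iff_shift[of "cons0 \<omega>"] by (simp add: mem_Omega0_pm_iff)
  then have "\<not> digit s (val \<omega> / B)"
    using Omega_pm_head_eq_digit[of "cons0 \<omega>"] by (simp add: val_cons0)
  then show ?thesis by (simp add: not_digit_iff below_divide_crit_iff)
qed

lemma Omega0_pm_eq_itineraries: "Omega0_pm s \<alpha> \<beta> = itin s ` {y. 0 \<le> y \<and> below s y M}"
proof (intro equalityI subsetI)
  fix \<omega> assume "\<omega> \<in> Omega0_pm s \<alpha> \<beta>"
  moreover from this have "\<omega> = itin s (val \<omega>)"
    by (intro Omega_pm_eq_itin_val) (simp add: mem_Omega0_pm_iff)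
  ultimately show "\<omega> \<in> itin s ` {y. 0 \<le> y \<and> below s y M}"
    using Omega0_pm_val_below_M val_nonneg by blast
qed (use itin_mem_Omega0_pm in auto)

lemma not_null_pair_\<alpha>_\<beta>: "\<not> null_pair \<alpha> \<beta>"
proof -
  have "{0..M} \<subseteq> val ` Omega_pair \<alpha> \<beta>"
  proof
    fix y assume "y \<in> {0..M}"
    then have "itin False y \<in> Omega_pair \<alpha> \<beta>" "val (itin False y) = y"
      using itin_mem_Omega_pm[of y False] val_itin by (auto simp: Omega_pair_def Omega_pm_def)
    then show "y \<in> val ` Omega_pair \<alpha> \<beta>" by (metis image_eqI)
  qed
  then have "ereal (- ln (1 / B)) \<le> entropy (Omega_pair \<alpha> \<beta>)"
    using B_gt_1 B_le_M by (intro entropy_ge_if_interval_subset_values[where a = 0 and b = M]) auto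
  moreover have "0 < ereal (- ln (1 / B))" using B_gt_1 by (simp add: ln_div)
  ultimately show ?thesis by (auto simp: null_pair_def)
qed

subsection \<open>Minimality of the root \<open>1 / B\<close>\<close>

text \<open>Suppose that the power series of \<open>\<alpha>\<close> and \<open>\<beta>\<close> agree at \<open>t\<close>. Put weight \<open>t\<^sup>n\<close> on the half-line
  to the left of the \<open>n\<close>-th point of an orbit of \<open>crit\<close>. The difference of the total weights of the two
  orbits is an eigenfunction, with eigenvalue \<open>1 / t\<close>, of the transfer operator, which sums a
  function over the preimages of a point. This operator has \<open>L\<^sup>1\<close> norm at most \<open>B\<close>, so \<open>t < 1 / B\<close>
  would force the difference to vanish almost everywhere; but it is positive just below \<open>M\<close>.\<close>

definition transfer :: "(real \<Rightarrow> real) \<Rightarrow> real \<Rightarrow> real" where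
  "transfer f y = of_bool (y < M) * f (y / B) + of_bool (M - B \<le> y) * f (y / B + 1)"

definition orbit_weight :: "real \<Rightarrow> bool \<Rightarrow> real \<Rightarrow> real" where
  "orbit_weight t s y = strval t (\<lambda>n. y < (T s ^^ n) crit)"

definition orbit_weight_gap :: "real \<Rightarrow> real \<Rightarrow> real" where
  "orbit_weight_gap t y = orbit_weight t False y - orbit_weight t True y"

lemma nn_integral_transfer_le:
  assumes [measurable]: "f \<in> borel_measurable borel"
  shows "(\<integral>\<^sup>+y. ennreal \<bar>transfer f y\<bar> \<partial>lborel)
    \<le> ennreal B * (\<integral>\<^sup>+y. ennreal \<bar>f y\<bar> \<partial>lborel)"
proof -
  define left where "left = (\<lambda>y. ennreal \<bar>f y\<bar> * indicator {..<crit} y)"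
  define right where "right = (\<lambda>y. ennreal \<bar>f y\<bar> * indicator {crit..} y)"
  have left_right_measurable [measurable]:
    "left \<in> borel_measurable borel" "right \<in> borel_measurable borel"
    by (simp_all add: left_def right_def)
  have rescale: "(\<integral>\<^sup>+y. g (y / B + k) \<partial>lborel) = ennreal B * (\<integral>\<^sup>+y. g y \<partial>lborel)"
    if [measurable]: "g \<in> borel_measurable borel" for g :: "real \<Rightarrow> ennreal" and k
    using nn_integral_real_affine[OF that, of "1 / B" k] B_gt_1
    by (simp add: mult.assoc[symmetric] ennreal_mult[symmetric] add.commute)
  have "y < M \<longleftrightarrow> y / B < crit" "M - B \<le> y \<longleftrightarrow> crit \<le> y / B + 1" for y
    using B_gt_1 by (simp_all add: crit_def field_simps)
  then have "ennreal \<bar>transfer f y\<bar> \<le> left (y / B + 0) + right (y / B + 1)" for y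
    by (auto simp: transfer_def left_def right_def abs_triangle_ineq simp flip: ennreal_plus
        split: split_indicator)
  then have "(\<integral>\<^sup>+y. ennreal \<bar>transfer f y\<bar> \<partial>lborel)
      \<le> (\<integral>\<^sup>+y. left (y / B + 0) + right (y / B + 1) \<partial>lborel)"
    by (intro nn_integral_mono)
  also have "\<dots> = (\<integral>\<^sup>+y. left (y / B + 0) \<partial>lborel) + (\<integral>\<^sup>+y. right (y / B + 1) \<partial>lborel)"
    by (rule nn_integral_add) measurable
  also have "\<dots> = ennreal B * ((\<integral>\<^sup>+y. left y \<partial>lborel) + (\<integral>\<^sup>+y. right y \<partial>lborel))"
    by (simp only: rescale left_right_measurable distrib_left)
  also have "(\<integral>\<^sup>+y. left y \<partial>lborel) + (\<integral>\<^sup>+y. right y \<partial>lborel) = (\<integral>\<^sup>+y. ennreal \<bar>f y\<bar> \<partial>lborel)"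
    by (subst nn_integral_add[symmetric])
       (auto intro!: nn_integral_cong simp: left_def right_def split: split_indicator)
  finally show ?thesis .
qed

lemma borel_measurable_transfer:
  assumes [measurable]: "f \<in> borel_measurable borel"
  shows "transfer f \<in> borel_measurable borel"
  unfolding transfer_def[abs_def] by measurable

lemma transfer_less_indicator:
  "transfer (\<lambda>y. of_bool (y < a)) y =
     of_bool (y < T s a) + of_bool (digit s a) * (of_bool (y < M) - of_bool (y < M - B))"
proof -
  have "y / B < a \<longleftrightarrow> y < B * a" "y / B + 1 < a \<longleftrightarrow> y < B * (a - 1)"
    using B_gt_1 by (simp_all add: field_simps)
  moreover have "M \<le> B * a" if "digit s a"
    using below_imp_le[of "\<not> s" crit a] that B_gt_1 by (simp add: digit_def crit_def field_simps)
  moreover have "B * a \<le> M" if "\<not> digit s a"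
    using below_imp_le[of s a crit] that B_gt_1 by (simp add: not_digit_iff crit_def field_simps)
  ultimately show ?thesis
    by (auto simp: transfer_def T_def right_diff_distrib)
qed

context
  fixes t :: real
  assumes t_pos: "0 < t" and t_less_1: "t < 1"
begin

lemma transfer_orbit_weight:
  "t * transfer (orbit_weight t s) y =
     orbit_weight t s y - of_bool (y < crit)
       + t * strval t (itin s crit) * (of_bool (y < M) - of_bool (y < M - B))"
proof -
  let ?thresholds = "\<lambda>n. y < (T s ^^ n) crit"
  define D :: real where "D = of_bool (y < M) - of_bool (y < M - B)"
  note summable = summable_strval[OF less_imp_le[OF t_pos] t_less_1]
  have "transfer (orbit_weight t s) y
      = (\<Sum>n. transfer (\<lambda>y. of_bool (y < (T s ^^ n) crit)) y * t ^ n)"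
    unfolding transfer_def orbit_weight_def strval_def
    by (simp add: suminf_add summable_mult summable suminf_mult[symmetric] distrib_right mult.assoc)
  also have "\<dots> = (\<Sum>n. of_bool (shift ?thresholds n) * t ^ n
      + D * (of_bool (itin s crit n) * t ^ n))"
    unfolding transfer_less_indicator[of _ _ s] D_def[symmetric] itin_def shift_def
    by (simp add: algebra_simps)
  also have "\<dots> = strval t (shift ?thresholds) + D * strval t (itin s crit)"
    unfolding strval_def
    by (simp only: suminf_add[OF summable summable_mult[OF summable], symmetric]
        suminf_mult[OF summable])
  finally show ?thesis
    using strval_unfold[of t ?thresholds] t_pos t_less_1
    unfolding D_def[symmetric] by (simp add: orbit_weight_def algebra_simps)
qed

lemma transfer_orbit_weight_gap:
  assumes "strval t \<alpha> = strval t \<beta>"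
  shows "t * transfer (orbit_weight_gap t) y = orbit_weight_gap t y"
proof -
  have "transfer (orbit_weight_gap t) y
      = transfer (orbit_weight t False) y - transfer (orbit_weight t True) y"
    by (simp add: transfer_def orbit_weight_gap_def right_diff_distrib)
  then show ?thesis
    using transfer_orbit_weight[of False y] transfer_orbit_weight[of True y] assms
    by (simp add: orbit_weight_gap_def right_diff_distrib \<alpha>_def \<beta>_def)
qed

lemma borel_measurable_orbit_weight_gap: "orbit_weight_gap t \<in> borel_measurable borel"
  unfolding orbit_weight_gap_def[abs_def] orbit_weight_def strval_def by measurable

lemma abs_orbit_weight_gap_le: "\<bar>orbit_weight_gap t y\<bar> \<le> 1 / (1 - t) * indicator {0..M} y"
proof -
  note bounds = strval_nonneg[of t] strval_le[of t]
  consider (left) "y < 0" | (inside) "y \<in> {0..M}" | (right) "M < y" by force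
  then show ?thesis
  proof cases
    case left
    then have "y < (T s ^^ n) crit" for s n
      using T_funpow_range[OF crit_range, of n s] by simp
    then show ?thesis using left by (simp add: orbit_weight_gap_def orbit_weight_def)
  next
    case inside
    then show ?thesis
      using bounds[of "\<lambda>n. y < (T False ^^ n) crit"] bounds[of "\<lambda>n. y < (T True ^^ n) crit"]
        t_pos t_less_1
      by (auto simp: orbit_weight_gap_def orbit_weight_def)
  next
    case right
    then have "\<not> y < (T s ^^ n) crit" for s n
      using T_funpow_range[OF crit_range, of n s] by simp
    then show ?thesis using right by (simp add: orbit_weight_gap_def orbit_weight_def)
  qed
qed

lemma T_True_funpow_crit_less_M: "(T True ^^ n) crit < M"
proof (induction n)
  case 0
  show ?case using crit_less_M by simp
next
  case (Suc n)
  let ?y = "(T True ^^ n) crit"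
  have "B * ?y < M" if "\<not> digit True ?y"
    using that B_gt_1 by (simp add: not_digit_iff below_def crit_def field_simps)
  moreover have "B * (?y - 1) < B * (M - 1)" using Suc B_gt_1 by simp
  ultimately show ?case using right_branch_le by (auto simp: T_def[of True ?y])
qed

text \<open>The orbit of \<open>crit\<close> under \<open>T False\<close> reaches \<open>M\<close> in one step, while that under \<open>T True\<close> comes
  near \<open>M\<close> only after many steps, which carry little weight.\<close>

lemma orbit_weight_gap_ge_near_M: "\<exists>a<M. \<forall>y\<in>{a<..<M}. t / 2 \<le> orbit_weight_gap t y"
proof -
  note t_bounds = less_imp_le[OF t_pos] t_less_1
  obtain N where N_large: "t ^ N < t / 2 * (1 - t)"
    using real_arch_pow_inv[of "t / 2 * (1 - t)" t] t_pos t_less_1 by auto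
  define a where "a = Max (insert 0 ((\<lambda>n. (T True ^^ n) crit) ` {..<N}))"
  have "a < M"
    using T_True_funpow_crit_less_M crit_less_M crit_range by (auto simp: a_def)
  moreover have "t / 2 \<le> orbit_weight_gap t y" if "a < y" "y < M" for y
  proof -
    let ?late = "\<lambda>n. y < (T True ^^ n) crit"
    have "(T True ^^ n) crit \<le> a" if "n < N" for n
      using that unfolding a_def by (intro Max_ge) auto
    then have "\<not> ?late n" if "n < N" for n
      using \<open>a < y\<close> that by fastforce
    then have "orbit_weight t True y = t ^ N * strval t ((shift ^^ N) ?late)"
      using strval_split_initial_segment[OF t_bounds, of ?late N] by (simp add: orbit_weight_def)
    also have "\<dots> \<le> t ^ N * (1 / (1 - t))"
      using t_pos by (intro mult_left_mono strval_le[OF t_bounds]) auto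
    also have "\<dots> \<le> t / 2" using N_large t_less_1 by (simp add: field_simps)
    finally have "orbit_weight t True y \<le> t / 2" .
    moreover have "T False crit = M" using B_crit by (simp add: T_def digit_def below_def)
    then have "t \<le> orbit_weight t False y"
      using strval_split_initial_segment[OF t_bounds, of "\<lambda>n. y < (T False ^^ n) crit" 2]
        \<open>y < M\<close> t_pos
      by (simp add: orbit_weight_def numeral_2_eq_2 strval_nonneg[OF t_bounds])
    ultimately show ?thesis by (simp add: orbit_weight_gap_def)
  qed
  ultimately show ?thesis by auto
qed

lemma nn_integral_orbit_weight_gap_pos: "0 < (\<integral>\<^sup>+y. ennreal \<bar>orbit_weight_gap t y\<bar> \<partial>lborel)"
proof -
  obtain a where "a < M" and gap_ge: "\<forall>y\<in>{a<..<M}. t / 2 \<le> orbit_weight_gap t y"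
    using orbit_weight_gap_ge_near_M by blast
  have "0 < ennreal (t / 2) * emeasure lborel {a<..<M}"
    using \<open>a < M\<close> t_pos by (simp add: ennreal_zero_less_mult_iff)
  also have "\<dots> = (\<integral>\<^sup>+y. ennreal (t / 2) * indicator {a<..<M} y \<partial>lborel)"
    by (simp add: nn_integral_cmult_indicator)
  also have "\<dots> \<le> (\<integral>\<^sup>+y. ennreal \<bar>orbit_weight_gap t y\<bar> \<partial>lborel)"
  proof (intro nn_integral_mono)
    show "ennreal (t / 2) * indicator {a<..<M} y \<le> ennreal \<bar>orbit_weight_gap t y\<bar>" for y
      using gap_ge order_trans[OF _ abs_ge_self, of "t / 2" "orbit_weight_gap t y"]
      by (auto intro!: ennreal_leI split: split_indicator)
  qed
  finally show ?thesis .
qed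

lemma nn_integral_orbit_weight_gap_finite:
  "(\<integral>\<^sup>+y. ennreal \<bar>orbit_weight_gap t y\<bar> \<partial>lborel) < \<infinity>"
proof -
  have "(\<integral>\<^sup>+y. ennreal \<bar>orbit_weight_gap t y\<bar> \<partial>lborel)
      \<le> (\<integral>\<^sup>+y. ennreal (1 / (1 - t)) * indicator {0..M} y \<partial>lborel)"
  proof (intro nn_integral_mono)
    show "ennreal \<bar>orbit_weight_gap t y\<bar> \<le> ennreal (1 / (1 - t)) * indicator {0..M} y" for y
      using abs_orbit_weight_gap_le[of y] by (auto intro!: ennreal_leI split: split_indicator_asm)
  qed
  also have "\<dots> < \<infinity>"
    by (simp add: nn_integral_cmult_indicator ennreal_mult_less_top emeasure_lborel_Icc_eq)
  finally show ?thesis .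
qed

lemma root_ge_inverse_base:
  assumes "strval t \<alpha> = strval t \<beta>"
  shows "1 / B \<le> t"
proof -
  let ?norm = "\<integral>\<^sup>+y. ennreal \<bar>orbit_weight_gap t y\<bar> \<partial>lborel"
  obtain r where norm_eq: "?norm = ennreal r" and "0 < r"
    using nn_integral_orbit_weight_gap_pos nn_integral_orbit_weight_gap_finite
    by (cases ?norm) auto
  have "?norm = (\<integral>\<^sup>+y. ennreal t * ennreal \<bar>transfer (orbit_weight_gap t) y\<bar> \<partial>lborel)"
    using t_pos transfer_orbit_weight_gap[OF assms]
    by (simp add: ennreal_mult[symmetric] abs_mult_pos')
  also have "\<dots> = ennreal t * (\<integral>\<^sup>+y. ennreal \<bar>transfer (orbit_weight_gap t) y\<bar> \<partial>lborel)"
    using borel_measurable_transfer[OF borel_measurable_orbit_weight_gap]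
    by (intro nn_integral_cmult) simp
  also have "\<dots> \<le> ennreal t * (ennreal B * ?norm)"
    by (intro mult_left_mono nn_integral_transfer_le borel_measurable_orbit_weight_gap) simp
  finally have "1 * r \<le> t * B * r"
    using norm_eq \<open>0 < r\<close> t_pos B_gt_1 by (simp add: ennreal_mult[symmetric] mult.assoc)
  then show ?thesis using \<open>0 < r\<close> B_gt_1 by (simp add: divide_le_eq)
qed

end

lemma pair_base_\<alpha>_\<beta>: "pair_base \<alpha> \<beta> = B"
proof -
  have "(LEAST x. x \<in> {1/2..<1} \<and> strval x \<alpha> = strval x \<beta>) = 1 / B"
  proof (rule Least_equality)
    show "1 / B \<in> {1/2..<1} \<and> val \<alpha> = val \<beta>"
      using B_le_2 B_gt_1 val_\<alpha> val_\<beta> by (simp add: field_simps)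
  qed (use root_ge_inverse_base in auto)
  then show ?thesis by (simp add: pair_base_def strval_def)
qed

end

section \<open>Radix systems\<close>

locale radix_strings = radix_base B for B :: real +
  fixes H :: "bstring set"
  assumes shift_mem: "\<omega> \<in> H \<Longrightarrow> shift \<omega> \<in> H"
    and cons0_mem: "\<omega> \<in> H \<Longrightarrow> cons0 \<omega> \<in> H"
    and val_strict_mono: "\<sigma> \<in> H \<Longrightarrow> \<omega> \<in> H \<Longrightarrow> less_fun \<sigma> \<omega> \<Longrightarrow> val \<sigma> < val \<omega>"
    and scaled_val_onto: "0 \<le> y \<Longrightarrow> \<exists>N. \<exists>\<omega>\<in>H. y = B ^ N * val \<omega>"
begin

definition M :: real where "M = Sup (val ` H)"

definition sign :: bool where "sign \<longleftrightarrow> M \<notin> val ` H"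

lemma val_inj: "\<sigma> \<in> H \<Longrightarrow> \<omega> \<in> H \<Longrightarrow> val \<sigma> = val \<omega> \<Longrightarrow> \<sigma> = \<omega>"
  using less_fun_linear[of \<sigma> \<omega>] val_strict_mono[of \<sigma> \<omega>] val_strict_mono[of \<omega> \<sigma>] by auto

lemma funpow_shift_mem: "\<omega> \<in> H \<Longrightarrow> (shift ^^ n) \<omega> \<in> H"
  by (induction n) (auto intro: shift_mem)

text \<open>A string whose value is at most \<open>val \<rho> / B = val (cons0 \<rho>)\<close> begins with 0, so shifting it
  multiplies its value by \<open>B\<close>.\<close>

lemma scaled_val_mem_values:
  assumes "\<rho> \<in> H" "\<omega> \<in> H" "B ^ N * val \<omega> \<le> val \<rho>"
  shows "B ^ N * val \<omega> \<in> val ` H"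
  using assms(2,3)
proof (induction N arbitrary: \<omega>)
  case (Suc N)
  have "\<not> \<omega> 0"
  proof
    assume "\<omega> 0"
    then have "val \<rho> / B < val \<omega>"
      using val_strict_mono[OF cons0_mem[OF assms(1)] Suc.prems(1)] less_fun_headI
      by (simp add: val_cons0)
    then have "val \<rho> < B ^ 1 * val \<omega>" using B_gt_1 by (simp add: field_simps)
    also have "\<dots> \<le> B ^ Suc N * val \<omega>"
      using B_gt_1 val_nonneg by (intro mult_right_mono power_increasing) auto
    finally show False using Suc.prems(2) by simp
  qed
  then have "B ^ Suc N * val \<omega> = B ^ N * val (shift \<omega>)" by (simp add: val_shift)
  then show ?case using Suc shift_mem by metis
qed simp

lemma val_le_M: "\<omega> \<in> H \<Longrightarrow> val \<omega> \<le> M"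
  unfolding M_def using val_le by (auto intro!: cSup_upper bdd_aboveI[of _ "1 / (1 - 1 / B)"])

lemma values_eq_interval: "val ` H = {y. 0 \<le> y \<and> below sign y M}"
proof (intro equalityI subsetI)
  fix y assume "y \<in> val ` H"
  then show "y \<in> {y. 0 \<le> y \<and> below sign y M}"
    using val_le_M val_nonneg by (force simp: below_def sign_def order_less_le)
next
  fix y assume "y \<in> {y. 0 \<le> y \<and> below sign y M}"
  then have "0 \<le> y" and y_below: "below sign y M" by auto
  then obtain N \<omega> where \<omega>: "\<omega> \<in> H" "y = B ^ N * val \<omega>" using scaled_val_onto by blast
  show "y \<in> val ` H"
  proof (cases "y = M")
    case True
    then show ?thesis using y_below by (auto simp: below_def sign_def split: if_splits)
  next
    case False
    then have "y < Sup (val ` H)" using below_imp_le[OF y_below] by (simp add: M_def)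
    then obtain \<rho> where "\<rho> \<in> H" "y < val \<rho>" using less_cSupD[of "val ` H" y] \<omega>(1) by blast
    then show ?thesis using scaled_val_mem_values[of \<rho> \<omega> N] \<omega> by simp
  qed
qed

lemma M_pos: "0 < M"
proof -
  obtain N \<omega> where \<omega>: "\<omega> \<in> H" "1 = B ^ N * val \<omega>" using scaled_val_onto[of 1] by auto
  then have "val \<omega> \<noteq> 0" by auto
  then show ?thesis using val_nonneg[of \<omega>] val_le_M[OF \<omega>(1)] by linarith
qed

lemma head_iff_not_below:
  assumes "\<omega> \<in> H"
  shows "\<omega> 0 \<longleftrightarrow> \<not> below sign (val \<omega>) (M / B)"
proof (cases "\<omega> 0")
  case True
  have "\<not> below sign (val \<omega>) (M / B)"
  proof
    assume "below sign (val \<omega>) (M / B)"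
    then have "below sign (B * val \<omega>) M"
      using below_divide_iff[of B sign "B * val \<omega>" M] B_gt_1 by simp
    then have "B * val \<omega> \<in> val ` H" using values_eq_interval val_nonneg B_gt_1 by simp
    then obtain \<sigma> where \<sigma>: "\<sigma> \<in> H" "val \<sigma> = B * val \<omega>" by force
    then have "val (cons0 \<sigma>) = val \<omega>" using B_gt_1 by (simp add: val_cons0)
    then have "cons0 \<sigma> = \<omega>" using val_inj cons0_mem \<sigma>(1) assms by blast
    then show False using True cons0_0 by blast
  qed
  then show ?thesis using True by simp
next
  case False
  then have "val \<omega> = val (shift \<omega>) / B" using B_gt_1 by (simp add: val_shift)
  moreover have "below sign (val (shift \<omega>)) M" using values_eq_interval shift_mem[OF assms] by auto
  ultimately show ?thesis using False B_gt_1 by (simp add: below_divide_iff)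
qed

lemma right_branch_range:
  assumes "M / B < y" "y < M"
  shows "1 \<le> y" "B * (y - 1) \<le> M"
proof -
  have "0 \<le> M / B" using M_pos B_gt_1 by simp
  then have "y \<in> val ` H" unfolding values_eq_interval using assms less_imp_below[of y M] by simp
  then obtain \<omega> where \<omega>: "\<omega> \<in> H" "val \<omega> = y" by auto
  then have "\<omega> 0" using head_iff_not_below below_imp_le[of sign y "M / B"] assms(1) by auto
  then have "val (shift \<omega>) = B * (y - 1)" using \<omega>(2) by (simp add: val_shift)
  then show "1 \<le> y" "B * (y - 1) \<le> M"
    using val_nonneg[of "shift \<omega>"] val_le_M[OF shift_mem[OF \<omega>(1)]] B_gt_1
    by (auto simp: zero_le_mult_iff)
qed

sublocale critical_map B M
proof
  have M_div_B_less_M: "M / B < M" using M_pos B_gt_1 by (simp add: field_simps)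
  have "1 \<le> M / B"
    using M_div_B_less_M right_branch_range(1) by (rule dense_ge_bounded)
  then show "B \<le> M" using B_gt_1 by simp
  have "y \<le> M / B + 1" if "M / B < y" "y < M" for y
    using right_branch_range(2)[OF that] B_gt_1 by (simp add: field_simps)
  with M_div_B_less_M have "M \<le> M / B + 1" by (rule dense_le_bounded)
  then show "B * (M - 1) \<le> M" using B_gt_1 by (simp add: field_simps)
qed

lemma strings_eq_Omega0_pm: "H = Omega0_pm sign \<alpha> \<beta>"
proof -
  have "\<omega> = itin sign (val \<omega>)" if "\<omega> \<in> H" for \<omega>
  proof (rule eq_itin_val)
    fix n
    have "(shift ^^ n) \<omega> 0 = digit sign (val ((shift ^^ n) \<omega>))"
      using head_iff_not_below[OF funpow_shift_mem[OF that]] not_digit_iff by (auto simp: crit_def)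
    then show "\<omega> n = digit sign (val ((shift ^^ n) \<omega>))" by (simp add: funpow_shift_head)
  qed
  then have "H = itin sign ` val ` H" by (auto simp: image_image) 
  then show ?thesis unfolding values_eq_interval Omega0_pm_eq_itineraries .
qed

end

lemma point_at_mem_if_hat:
  assumes "shift_invariant \<Gamma>" "\<omega> \<in> hat \<Gamma>"
  shows "point_at N \<omega> \<in> \<Gamma>"
proof -
  have "point_at N \<omega> \<in> dot ((shift ^^ 0) ` hat \<Gamma>)" using assms(2) by (auto simp: dot_def)
  then show ?thesis using assms(1) unfolding shift_invariant_def by blast
qed

lemma shift_mem_hat:
  assumes "shift_invariant \<Gamma>" "\<omega> \<in> hat \<Gamma>"
  shows "shift \<omega> \<in> hat \<Gamma>"
proof -
  have "point_at 0 (shift \<omega>) \<in> dot ((shift ^^ 1) ` hat \<Gamma>)" using assms(2) by (auto simp: dot_def)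
  then have "point_at 0 (shift \<omega>) \<in> \<Gamma>" using assms(1) unfolding shift_invariant_def by blast
  then show ?thesis unfolding hat_def by blast
qed

lemma cons0_mem_hat:
  assumes "shift_invariant \<Gamma>" "\<omega> \<in> hat \<Gamma>"
  shows "cons0 \<omega> \<in> hat \<Gamma>"
  using point_at_mem_if_hat[OF assms, of 0] point_at_eq_iff[of 0 \<omega> 1 "cons0 \<omega>"]
  unfolding hat_def by auto

lemma dec_less_point_at: "less_fun \<sigma> \<omega> \<Longrightarrow> dec_less (point_at N \<sigma>) (point_at N \<omega>)"
  using point_at_eq_iff[of N \<sigma> 0 \<omega>] less_fun_irrefl[of \<sigma>] unfolding dec_less_def by auto

lemma radix_strings_hat:
  assumes "binary_radix_system \<Gamma> \<pi> B"
  shows "radix_strings B (hat \<Gamma>)"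
proof
  have decimals: "\<Gamma> \<subseteq> dot UNIV" and inv: "shift_invariant \<Gamma>"
    and bij: "bij_betw \<pi> \<Gamma> {0..}" and mono: "monotone_on \<Gamma> dec_less (<) \<pi>"
    using assms by (auto simp: binary_radix_system_def)
  show B_gt_1: "1 < B" using assms by (simp add: binary_radix_system_def)
  have \<pi>_point_at: "\<pi> (point_at N \<omega>) = B ^ N * strval (1 / B) \<omega>" if "\<omega> \<in> hat \<Gamma>" for N \<omega>
    using assms point_at_mem_if_hat[OF inv that] dec_value_point_at_eq_strval[OF B_gt_1]
    by (simp add: binary_radix_system_def)
  show "\<omega> \<in> hat \<Gamma> \<Longrightarrow> shift \<omega> \<in> hat \<Gamma>" "\<omega> \<in> hat \<Gamma> \<Longrightarrow> cons0 \<omega> \<in> hat \<Gamma>" for \<omega>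
    using inv by (simp_all add: shift_mem_hat cons0_mem_hat)
  show "strval (1 / B) \<sigma> < strval (1 / B) \<omega>"
    if "\<sigma> \<in> hat \<Gamma>" "\<omega> \<in> hat \<Gamma>" "less_fun \<sigma> \<omega>" for \<sigma> \<omega>
    using monotone_onD[OF mono point_at_mem_if_hat[OF inv that(1)] point_at_mem_if_hat[OF inv that(2)]]
      dec_less_point_at[OF that(3), of 0] \<pi>_point_at[of _ 0] that by fastforce
  show "\<exists>N. \<exists>\<omega>\<in>hat \<Gamma>. y = B ^ N * strval (1 / B) \<omega>" if "0 \<le> y" for y
  proof -
    have "y \<in> \<pi> ` \<Gamma>" using bij that by (simp add: bij_betw_def)
    then obtain N \<omega> where "point_at N \<omega> \<in> \<Gamma>" "y = \<pi> (point_at N \<omega>)"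
      using decimals by (auto simp: dot_def)
    then show ?thesis using \<pi>_point_at unfolding hat_def by blast
  qed
qed

theorem mainTheorem5:
  fixes \<Gamma> :: "decimal set" and \<pi> :: "decimal \<Rightarrow> real" and B :: real
  assumes "binary_radix_system \<Gamma> \<pi> B"
  shows "\<exists>\<alpha> \<beta>. admissible \<alpha> \<beta> \<and> \<not> null_pair \<alpha> \<beta> \<and>
           (R_minus \<alpha> \<beta> = (\<Gamma>, \<pi>, B) \<or> R_plus \<alpha> \<beta> = (\<Gamma>, \<pi>, B))"
proof -
  interpret radix_strings B "hat \<Gamma>" by (rule radix_strings_hat[OF assms])
  have "dot (hat \<Gamma>) = \<Gamma>"
    using assms by (auto simp: binary_radix_system_def shift_invariant_def dest: spec[of _ 0])
  then have "dot (Omega0_pm sign \<alpha> \<beta>) = \<Gamma>" by (simp flip: strings_eq_Omega0_pm)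
  moreover have "restrict (dec_value B) \<Gamma> = \<pi>"
    using assms
    by (auto simp: binary_radix_system_def fun_eq_iff restrict_def PiE_def extensional_def)
  ultimately have "R_minus \<alpha> \<beta> = (\<Gamma>, \<pi>, B) \<or> R_plus \<alpha> \<beta> = (\<Gamma>, \<pi>, B)"
    by (cases sign) (simp_all add: Omega0_pm_def R_minus_def R_plus_def pair_base_\<alpha>_\<beta>)
  then show ?thesis using admissible_\<alpha>_\<beta> not_null_pair_\<alpha>_\<beta> by blast
qed

end
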